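(* Let $q$ be an indeterminate and, for $n\ge 1$, let $b_n=[2n-1]_q\,q^{(-1)^{n-1}n(n-1)/2-n+1}$. Then the $q$-tangent function $\tan_q(z)=\dfrac{\sin_q(z)}{\cos_q(z)}$ has the continued fraction expansion $$-z\tan_q(z)=-\cfrac{z^2}{b_1-\cfrac{z^2}{b_2-\cfrac{z^2}{b_3-\cfrac{z^2}{b_4-\dotsb}}}} =-\cfrac{z^2}{[1]_q q^{0}-\cfrac{z^2}{[3]_q q^{-2}-\cfrac{z^2}{[5]_q q^{1}-\cfrac{z^2}{[7]_q q^{-9}-\dotsb}}}}$$ as formal power series in $z$ with coefficients in $\mathbb{Q}(q)$.
   Context: Notation: $[n]_q:=\frac{1-q^n}{1-q}$ and $[n]_q!:=[1]_q[2]_q\cdots[n]_q$, with $[0]_q!=1$. The $q$-trigonometric functions (as defined by Prodinger) are the power series in $z$ $$\sin_q(z)=\sum_{n=0}^\infty\frac{(-1)^n z^{2n+1}}{[2n+1]_q!}q^{n^2},\qquad \cos_q(z)=\sum_{n=0}^\infty\frac{(-1)^n z^{2n}}{[2n]_q!}q^{n^2}.$$ The quotient $\tan_q=\sin_q/\cos_q$ is taken in the ring of formal power series $\mathbb{Q}(q)[[z]]$. The equality with the infinite continued fraction means that its $n$-th convergents (the finite continued fractions obtained by terminating after the term $b_n$, expanded as formal power series in $z$) converge coefficientwise, as $n\to\infty$, to $-z\tan_q(z)$. *)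

theory Defs
  imports
    "HOL-Computational_Algebra.Fraction_Field"
    "HOL-Computational_Algebra.Polynomial"
    "HOL-Computational_Algebra.Formal_Power_Series"
begin

text \<open>The field of rational functions over the rationals in the indeterminate \<open>q\<close>.\<close>

type_synonym ratfun = "rat poly fract"

definition q :: ratfun where
  "q = Fraction_Field.Fract [:0, 1:] 1"

definition qnum :: "nat \<Rightarrow> ratfun" where
  "qnum n = (1 - q ^ n) / (1 - q)"

definition qfact :: "nat \<Rightarrow> ratfun" where
  "qfact n = (\<Prod>i = 1..n. qnum i)"

definition sin_q :: "ratfun fps" where
  "sin_q = Abs_fps (\<lambda>m. if odd m
      then (- 1) ^ (m div 2) * q ^ ((m div 2) ^ 2) / qfact m else 0)"

definition cos_q :: "ratfun fps" where
  "cos_q = Abs_fps (\<lambda>m. if even m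
      then (- 1) ^ (m div 2) * q ^ ((m div 2) ^ 2) / qfact m else 0)"

text \<open>The constant coefficient of \<open>cos_q\<close> is 1, so this is the quotient in the ring of
  formal power series.\<close>

definition tan_q :: "ratfun fps" where
  "tan_q = sin_q / cos_q"

text \<open>Only the values at \<open>n \<ge> 1\<close> are used. The exponent of \<open>q\<close> may be negative.\<close>

definition b :: "nat \<Rightarrow> ratfun" where
  "b n = qnum (2 * n - 1) *
     q powi ((- 1) ^ (n - 1) * (int n * (int n - 1) div 2) - int n + 1)"

text \<open>\<open>cfrac_tail i m\<close> is
  \<open>z\<^sup>2 / (b i - z\<^sup>2 / (b (i + 1) - \<dots> - z\<^sup>2 / b (i + m - 1)))\<close>, with \<open>m\<close> partial
  denominators. For \<open>i \<ge> 1\<close> each denominator has the nonzero constant coefficient \<open>b j\<close>,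
  so every division is an exact division by a unit.\<close>

fun cfrac_tail :: "nat \<Rightarrow> nat \<Rightarrow> ratfun fps" where
  "cfrac_tail i 0 = 0"
| "cfrac_tail i (Suc m) = fps_X ^ 2 / (fps_const (b i) - cfrac_tail (Suc i) m)"

definition convergent_q :: "nat \<Rightarrow> ratfun fps" where
  "convergent_q n = - cfrac_tail 1 n"

text \<open>Coefficientwise convergence of formal power series, the coefficient field being
  discrete: each coefficient is eventually constant.\<close>

definition converges_coeffwise :: "(nat \<Rightarrow> 'a::zero fps) \<Rightarrow> 'a fps \<Rightarrow> bool" where
  "converges_coeffwise F G \<longleftrightarrow>
     (\<forall>k. eventually (\<lambda>n. fps_nth (F n) k = fps_nth G k) sequentially)"

end

theory Submission
  imports Defs
begin

unbundle fps_syntax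

text \<open>As in Lambert's proof for the classical tangent, \<open>cos_q\<close> and \<open>sin_q / z\<close> are the first
  two members of a sequence \<open>A\<^sub>0, A\<^sub>1, \<dots>\<close> of explicit power series in \<open>z\<^sup>2\<close> with nonzero constant
  coefficients that satisfy \<open>b\<^sub>i A\<^sub>i - A\<^sub>i\<^sub>-\<^sub>1 = z\<^sup>2 A\<^sub>i\<^sub>+\<^sub>1\<close>. Hence the quotients
  \<open>T\<^sub>i = z\<^sup>2 A\<^sub>i / A\<^sub>i\<^sub>-\<^sub>1\<close> satisfy \<open>T\<^sub>i = z\<^sup>2 / (b\<^sub>i - T\<^sub>i\<^sub>+\<^sub>1)\<close>, and each step of this recursion multiplies
  the error of a truncation by \<open>z\<^sup>2\<close> and a unit. Comparing coefficients, the recurrence reduces to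
  one of the two splittings of \<open>[2n + 2i - 1]\<^sub>q\<close> into multiples of \<open>[2n]\<^sub>q\<close> and \<open>[2i - 1]\<^sub>q\<close>; which one
  depends on the parity of \<open>i\<close>, whence the sign \<open>(-1)\<^sup>n\<^sup>-\<^sup>1\<close> in the exponent of \<open>b\<^sub>n\<close>.\<close>

lemma q_power: "q ^ n = Fraction_Field.Fract (monom 1 n) 1"
proof (induction n)
  case (Suc n)
  thus ?case by (simp add: q_def mult.commute flip: monom_Suc)
qed (simp add: One_fract_def)

lemma q_nonzero [simp]: "q \<noteq> 0"
  by (simp add: q_def Zero_fract_def eq_fract)

lemma q_power_neq_1: "n > 0 \<Longrightarrow> q ^ n \<noteq> 1"
  by (simp add: q_power One_fract_def eq_fract monom_eq_1_iff)

lemma qnum_eq_0_iff [simp]: "qnum n = 0 \<longleftrightarrow> n = 0"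
  using q_power_neq_1[of 1] q_power_neq_1[of n] by (auto simp: qnum_def)

text \<open>The power of \<open>q\<close> falls on the second summand only, so the two orders of
  summation give the two splittings used below.\<close>

lemma qnum_add: "qnum (m + n) = qnum m + q ^ m * qnum n"
  using q_power_neq_1[of 1] by (simp add: qnum_def field_simps power_add)

lemma qfact_Suc: "qfact (Suc n) = qfact n * qnum (Suc n)"
  by (simp add: qfact_def)

lemma qfact_nonzero [simp]: "qfact n \<noteq> 0"
  by (auto simp: qfact_def)

lemma b_nonzero: "n > 0 \<Longrightarrow> b n \<noteq> 0"
  by (simp add: b_def)

text \<open>Separating parities turns the integer power into natural ones: the exponent is
  nonnegative at odd indices and negative at even ones. For \<open>m = 0\<close> the factor
  \<open>m\<close> hides the truncation in \<open>2 * m - 1\<close>.\<close>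

lemma b_odd: "b (2 * m + 1) = qnum (4 * m + 1) * q ^ (m * (2 * m - 1))"
proof -
  have "int (2 * m + 1) * (int (2 * m + 1) - 1) = 2 * (int m * (2 * int m + 1))"
    by (simp add: algebra_simps)
  hence "int (2 * m + 1) * (int (2 * m + 1) - 1) div 2 = int m * (2 * int m + 1)"
    by linarith
  moreover have "int (m * (2 * m - 1)) = int m * (2 * int m - 1)"
    by (cases m) (simp_all add: algebra_simps)
  ultimately have "(- 1) ^ (2 * m + 1 - 1) * (int (2 * m + 1) * (int (2 * m + 1) - 1) div 2)
       - int (2 * m + 1) + 1 = int (m * (2 * m - 1))"
    by (simp add: algebra_simps)
  moreover have "2 * (2 * m + 1) - 1 = 4 * m + 1"
    by simp
  ultimately show ?thesis
    unfolding b_def by (simp only: power_int_of_nat)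
qed

lemma b_even: "b (2 * m + 2) = qnum (4 * m + 3) / q ^ ((2 * m + 1) * (m + 2))"
proof -
  have "int (2 * m + 2) * (int (2 * m + 2) - 1) = 2 * ((int m + 1) * (2 * int m + 1))"
    by (simp add: algebra_simps)
  hence "int (2 * m + 2) * (int (2 * m + 2) - 1) div 2 = (int m + 1) * (2 * int m + 1)"
    by linarith
  hence "(- 1) ^ (2 * m + 2 - 1) * (int (2 * m + 2) * (int (2 * m + 2) - 1) div 2)
       - int (2 * m + 2) + 1 = - int ((2 * m + 1) * (m + 2))"
    by (simp add: algebra_simps)
  moreover have "2 * (2 * m + 2) - 1 = 4 * m + 3"
    by simp
  ultimately show ?thesis
    unfolding b_def by (simp only: power_int_minus power_int_of_nat divide_inverse)
qed

text \<open>For \<open>i = 2 * m\<close> the extra term is the exponent of \<open>q\<close> in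
  \<open>b (Suc i)\<close>.\<close>

definition lambert_exp :: "nat \<Rightarrow> nat \<Rightarrow> nat" where
  "lambert_exp i n = (n + i div 2) ^ 2 + (if even i then i div 2 * (i - 1) else 0)"

text \<open>The product cancels the even factors of the factorial beyond \<open>[2n]\<close>.
  Setting \<open>q = 1\<close> formally gives the coefficients of \<open>z^(1-i) j_(i-1)(z)\<close>,
  with \<open>j\<close> the spherical Bessel function.\<close>

definition lambert_coeff :: "nat \<Rightarrow> nat \<Rightarrow> ratfun" where
  "lambert_coeff i n = (- 1) ^ n * q ^ lambert_exp i n *
     (\<Prod>j = 1..i. qnum (2 * n + 2 * j)) / qfact (2 * n + 2 * i)"

definition lambert :: "nat \<Rightarrow> ratfun fps" where
  "lambert i = Abs_fps (\<lambda>k. if even k then lambert_coeff i (k div 2) else 0)"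

lemma lambert_0: "lambert 0 = cos_q"
  by (simp add: lambert_def cos_q_def lambert_coeff_def lambert_exp_def fps_eq_iff)

lemma lambert_1: "fps_X * lambert 1 = sin_q"
proof (rule fps_ext)
  fix k
  show "(fps_X * lambert 1) $ k = sin_q $ k"
  proof (cases "odd k")
    case True
    then obtain n where "k = 2 * n + 1" by (elim oddE)
    \<comment> \<open>This factor, the whole product for \<open>i = 1\<close>, cancels and leaves
      \<open>[2n+1]!\<close>.\<close>
    moreover have "qnum (2 + 2 * n) \<noteq> 0" by simp
    ultimately show ?thesis
      by (simp add: lambert_def sin_q_def lambert_coeff_def lambert_exp_def qfact_Suc)
  qed (cases k; simp add: lambert_def sin_q_def)
qed

lemma lambert_nth_0_nonzero: "lambert i $ 0 \<noteq> 0"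
  by (simp add: lambert_def lambert_coeff_def)

text \<open>For \<open>n = 0\<close> the truncated \<open>n - 1\<close> is harmless because \<open>[2n]\<^sub>q\<close> vanishes.\<close>

lemma lambert_exp_rec:
  "b (Suc i) * q ^ lambert_exp (Suc i) n - q ^ lambert_exp i n * qnum (2 * n + 2 * i + 1)
     = - (q ^ lambert_exp (Suc (Suc i)) (n - 1) * qnum (2 * n))"
proof (cases "even i")
  case True
  then obtain m where i: "i = 2 * m" by blast
  \<comment> \<open>\<open>[4m+1]\<close> comes first, without a power of \<open>q\<close>, and
    cancels against the term with \<open>b (Suc i)\<close>.\<close>
  have "qnum (2 * n + 2 * i + 1) = qnum (4 * m + 1) + q ^ (4 * m + 1) * qnum (2 * n)"
    using qnum_add[of "4 * m + 1" "2 * n"] by (simp add: i algebra_simps)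
  moreover have "q ^ lambert_exp (Suc (Suc i)) (n - 1) * qnum (2 * n)
      = q ^ (lambert_exp i n + (4 * m + 1)) * qnum (2 * n)"
  proof (cases n)
    case (Suc k)
    have "lambert_exp (Suc (Suc i)) k = lambert_exp i (Suc k) + (4 * m + 1)"
      by (cases m) (simp_all add: lambert_exp_def i power2_eq_square algebra_simps)
    thus ?thesis by (simp add: Suc)
  qed simp
  moreover have "lambert_exp i n = lambert_exp (Suc i) n + m * (2 * m - 1)"
    by (simp add: lambert_exp_def i)
  hence "b (Suc i) * q ^ lambert_exp (Suc i) n = qnum (4 * m + 1) * q ^ lambert_exp i n"
    using b_odd[of m] by (simp add: i power_add)
  ultimately show ?thesis
    by (auto simp add: power_add algebra_simps)
next
  case False
  then obtain m where i: "i = 2 * m + 1" by (elim oddE)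
  \<comment> \<open>Now \<open>[4m+3]\<close> comes second; its factor \<open>q ^ (2 * n)\<close> is
    what remains once the denominator of \<open>b (Suc i)\<close> is cancelled.\<close>
  have "2 * n + 2 * i + 1 = 2 * n + (4 * m + 3)"
    by (simp add: i)
  hence "qnum (2 * n + 2 * i + 1) = qnum (2 * n) + q ^ (2 * n) * qnum (4 * m + 3)"
    by (simp only: qnum_add)
  moreover have "q ^ lambert_exp (Suc (Suc i)) (n - 1) * qnum (2 * n)
      = q ^ lambert_exp i n * qnum (2 * n)"
    by (cases n) (simp_all add: lambert_exp_def i)
  moreover have "lambert_exp (Suc i) n = (2 * m + 1) * (m + 2) + (lambert_exp i n + 2 * n)"
    by (simp add: lambert_exp_def i power2_eq_square algebra_simps)
  hence "b (Suc i) * q ^ lambert_exp (Suc i) n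
      = qnum (4 * m + 3) * q ^ (lambert_exp i n + 2 * n)"
    using b_even[of m] by (simp add: i power_add)
  ultimately show ?thesis
    by (auto simp add: power_add algebra_simps)
qed

lemma lambert_coeff_rec:
  "b (Suc i) * lambert_coeff (Suc i) n - lambert_coeff i n
     = (if n = 0 then 0 else lambert_coeff (Suc (Suc i)) (n - 1))"
proof -
  define P where "P = (\<Prod>j = 1..i. qnum (2 * n + 2 * j))"
  define x where "x = qnum (2 * n + 2 * i + 2)"
  define D where "D = qfact (2 * n + 2 * i)"
  define y where "y = qnum (2 * n + 2 * i + 1)"
  have nz: "x \<noteq> 0" "D \<noteq> 0" "y \<noteq> 0"
    by (simp_all add: x_def D_def y_def)
  have fact: "qfact (2 * n + 2 * Suc i) = D * y * x"
    by (simp add: D_def x_def y_def qfact_Suc)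
  have coeff: "lambert_coeff i n = (- 1) ^ n * q ^ lambert_exp i n * P / D"
    by (simp add: lambert_coeff_def P_def D_def)
  have coeff': "lambert_coeff (Suc i) n = (- 1) ^ n * q ^ lambert_exp (Suc i) n * (P * x) / (D * y * x)"
    unfolding lambert_coeff_def fact by (simp add: P_def x_def add.assoc)
  have "b (Suc i) * lambert_coeff (Suc i) n - lambert_coeff i n
      = (- 1) ^ n * P / (D * y) * (b (Suc i) * q ^ lambert_exp (Suc i) n - q ^ lambert_exp i n * y)"
    using nz by (simp add: coeff coeff' field_simps)
  also have "\<dots> = - ((- 1) ^ n * P / (D * y) * (q ^ lambert_exp (Suc (Suc i)) (n - 1) * qnum (2 * n)))"
    by (simp only: y_def lambert_exp_rec mult_minus_right)
  also have "\<dots> = (if n = 0 then 0 else lambert_coeff (Suc (Suc i)) (n - 1))"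
  proof (cases n)
    case 0
    thus ?thesis by simp
  next
    case (Suc k)
    \<comment> \<open>Since \<open>2 * k + 2 = 2 * n\<close>, the first factor is the
      \<open>[2n]\<close> supplied by \<open>lambert_exp_rec\<close>, and the others form the
      product for \<open>Suc i\<close> at \<open>n\<close>.\<close>
    have "(\<Prod>j = 1..Suc (Suc i). qnum (2 * k + 2 * j)) = qnum (2 * n) * (P * x)"
    proof -
      have "(\<Prod>j = 1..Suc (Suc i). qnum (2 * k + 2 * j))
          = qnum (2 * n) * (\<Prod>j = Suc 1..Suc (Suc i). qnum (2 * k + 2 * j))"
        by (subst prod.atLeast_Suc_atMost) (simp_all add: Suc)
      also have "(\<Prod>j = Suc 1..Suc (Suc i). qnum (2 * k + 2 * j)) = (\<Prod>j = 1..Suc i. qnum (2 * n + 2 * j))"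
        by (subst prod.shift_bounds_cl_Suc_ivl) (simp add: Suc)
      also have "\<dots> = P * x"
        by (simp add: P_def x_def add.assoc)
      finally show ?thesis .
    qed
    moreover have "qfact (2 * k + 2 * Suc (Suc i)) = D * y * x"
      using fact by (simp add: Suc)
    ultimately have "lambert_coeff (Suc (Suc i)) k
        = (- 1) ^ k * q ^ lambert_exp (Suc (Suc i)) k * (qnum (2 * n) * (P * x)) / (D * y * x)"
      by (simp only: lambert_coeff_def)
    thus ?thesis using nz by (simp add: Suc field_simps)
  qed
  finally show ?thesis .
qed

lemma lambert_rec:
  "fps_const (b (Suc i)) * lambert (Suc i) - lambert i = fps_X ^ 2 * lambert (Suc (Suc i))"
proof (rule fps_ext)
  fix k
  show "(fps_const (b (Suc i)) * lambert (Suc i) - lambert i) $ k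
      = (fps_X ^ 2 * lambert (Suc (Suc i))) $ k"
  proof (cases "even k")
    case True
    then obtain n where "k = 2 * n" by blast
    thus ?thesis
      using lambert_coeff_rec[of i n]
      by (cases n) (simp_all add: lambert_def fps_X_power_mult_nth)
  next
    case False
    moreover have "k \<ge> 2 \<Longrightarrow> odd (k - 2)" using False by simp
    ultimately show ?thesis
      by (auto simp: lambert_def fps_X_power_mult_nth)
  qed
qed

text \<open>Hence each denominator has constant coefficient \<open>b i\<close> and is a
  unit.\<close>

lemma cfrac_tail_nth_0: "i > 0 \<Longrightarrow> cfrac_tail i m $ 0 = 0"
proof (induction m arbitrary: i)
  case (Suc m)
  hence "(fps_const (b i) - cfrac_tail (Suc i) m) $ 0 \<noteq> 0"
    by (simp add: b_nonzero)
  thus ?case by (simp add: fps_divide_unit)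
qed simp

lemma cfrac_tail_approx:
  "fps_X ^ (2 * m) dvd cfrac_tail (Suc i) m - fps_X ^ 2 * lambert (Suc i) / lambert i"
proof (induction m arbitrary: i)
  case (Suc m)
  define c where "c = fps_const (b (Suc i)) - cfrac_tail (Suc (Suc i)) m"
  define T where "T = fps_X ^ 2 * lambert (Suc (Suc i)) / lambert (Suc i)"
  have c0: "c $ 0 \<noteq> 0"
    by (simp add: c_def b_nonzero cfrac_tail_nth_0)
  note A0 = lambert_nth_0_nonzero
  \<comment> \<open>The three-term recurrence, read as a formula for the exact tail \<open>T\<close>
    that \<open>cfrac_tail (Suc (Suc i)) m\<close> approximates.\<close>
  have "T * lambert (Suc i) = fps_const (b (Suc i)) * lambert (Suc i) - lambert i"
    using inverse_mult_eq_1[OF A0[of "Suc i"]]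
    by (simp add: T_def fps_divide_unit A0 mult.assoc lambert_rec)
  hence A: "lambert i = (fps_const (b (Suc i)) - T) * lambert (Suc i)"
    by (simp add: algebra_simps)
  have "cfrac_tail (Suc i) (Suc m) - fps_X ^ 2 * lambert (Suc i) / lambert i
      = fps_X ^ 2 * inverse c * inverse (lambert i) * (lambert i - c * lambert (Suc i))"
  proof -
    \<comment> \<open>Each fraction is expanded by a factor equal to 1 to reach the common
      denominator \<open>c * lambert i\<close>.\<close>
    have "cfrac_tail (Suc i) (Suc m) = fps_X ^ 2 * inverse c * (inverse (lambert i) * lambert i)"
      by (simp add: c0 A0 inverse_mult_eq_1 fps_divide_unit flip: c_def)
    moreover have "fps_X ^ 2 * lambert (Suc i) / lambert i
        = fps_X ^ 2 * (inverse c * c) * lambert (Suc i) * inverse (lambert i)"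
      by (simp add: c0 A0 inverse_mult_eq_1 fps_divide_unit)
    ultimately show ?thesis by (simp only:) (simp add: algebra_simps)
  qed
  also have "lambert i - c * lambert (Suc i) = (cfrac_tail (Suc (Suc i)) m - T) * lambert (Suc i)"
    by (subst A) (simp add: c_def algebra_simps)
  finally have "cfrac_tail (Suc i) (Suc m) - fps_X ^ 2 * lambert (Suc i) / lambert i
      = fps_X ^ 2 * (cfrac_tail (Suc (Suc i)) m - T) * (inverse c * inverse (lambert i) * lambert (Suc i))"
    by (simp add: mult_ac)
  moreover have "fps_X ^ (2 * Suc m) dvd fps_X ^ 2 * (cfrac_tail (Suc (Suc i)) m - T)"
    using mult_dvd_mono[OF dvd_refl Suc.IH[of "Suc i"], of "fps_X ^ 2"]
    by (simp add: T_def flip: power_add)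
  ultimately show ?case by simp
qed simp

theorem mainTheorem1:
  shows "converges_coeffwise convergent_q (- (fps_X * tan_q)) \<and>
    b 1 = qnum 1 * q powi 0 \<and>
    b 2 = qnum 3 * q powi (- 2) \<and>
    b 3 = qnum 5 * q powi 1 \<and>
    b 4 = qnum 7 * q powi (- 9)"
proof (intro conjI)
  have tan: "fps_X * tan_q = fps_X ^ 2 * lambert 1 / lambert 0"
    using lambert_nth_0_nonzero[of 0]
    by (simp add: tan_q_def fps_divide_unit power2_eq_square mult.assoc
        flip: lambert_0 lambert_1)
  show "converges_coeffwise convergent_q (- (fps_X * tan_q))"
    unfolding converges_coeffwise_def
  proof
    fix k
    \<comment> \<open>The error has order at least \<open>2 * n\<close>, which exceeds
      \<open>k\<close>.\<close>
    have "convergent_q n $ k = (- (fps_X * tan_q)) $ k" if "n > k" for n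
    proof -
      obtain D where "cfrac_tail 1 n - fps_X * tan_q = fps_X ^ (2 * n) * D"
        using cfrac_tail_approx[of n 0] by (auto simp: tan elim: dvdE)
      moreover have "(fps_X ^ (2 * n) * D) $ k = 0"
        using that by (simp add: fps_X_power_mult_nth)
      ultimately have "(cfrac_tail 1 n - fps_X * tan_q) $ k = 0"
        by simp
      thus ?thesis by (simp add: convergent_q_def)
    qed
    thus "\<forall>\<^sub>F n in sequentially. convergent_q n $ k = (- (fps_X * tan_q)) $ k"
      by (auto simp: eventually_sequentially intro!: exI[of _ "Suc k"])
  qed
qed (simp_all add: b_def)

end
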